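(* Let $n\in\mathbb{N}$ and let $\mathbf{k}$ be a commutative ring. Let $i\in[n-1]$. Then, in $\mathbf{k}[S_n]$, $$[t_i,t_{i+1}]=t_i\,\bigl(t_{i+1}-(t_i-1)\bigr),\qquad [t_i,t_{i+1}]\,t_i=0,\qquad\text{and}\qquad [t_i,t_{i+1}]^2=0.$$
   Context: Here $\mathbb{N}=\{0,1,2,\ldots\}$, and $[m]:=\{1,2,\ldots,m\}$ (empty if $m\leq 0$). $S_n$ is the symmetric group on $[n]$, with product $(\pi\sigma)(i)=\pi(\sigma(i))$, viewed as a subset of the group algebra $\mathbf{k}[S_n]$. For distinct $i_1,\ldots,i_k\in[n]$, $\operatorname{cyc}_{i_1,\ldots,i_k}\in S_n$ is the cycle sending $i_1\mapsto i_2\mapsto\cdots\mapsto i_k\mapsto i_1$ and fixing all other elements (so $\operatorname{cyc}_i=\operatorname{id}=1$). For each $\ell\in[n]$, the somewhere-to-below shuffle is $t_\ell:=\operatorname{cyc}_{\ell}+\operatorname{cyc}_{\ell,\ell+1}+\operatorname{cyc}_{\ell,\ell+1,\ell+2}+\cdots+\operatorname{cyc}_{\ell,\ell+1,\ldots,n}\in\mathbf{k}[S_n]$. For elements $a,b$ of a ring, $[a,b]:=ab-ba$ is the commutator. *)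

theory Defs
  imports "HOL-Algebra.Sym_Groups" "HOL-Algebra.Ring"
begin

(* K[G]: the finitely supported functions carrier G \<rightarrow> carrier K (extended by undefined
   outside carrier G), where f stands for the formal sum of f(g) g over g in G.
   The convolution is (a b)(x) = sum of a(g) b(h) over all g, h with g h = x, that is,
   the sum of a(g) b(g^{-1} x) over the support of a. *)
definition group_algebra ::
    "('a, 'm) ring_scheme \<Rightarrow> ('g, 'n) monoid_scheme \<Rightarrow> ('g \<Rightarrow> 'a) ring" where
  "group_algebra K G =
    \<lparr> carrier = {f \<in> carrier G \<rightarrow>\<^sub>E carrier K. finite {g \<in> carrier G. f g \<noteq> \<zero>\<^bsub>K\<^esub>}},
      mult = (\<lambda>a b. \<lambda>x\<in>carrier G.
        \<Oplus>\<^bsub>K\<^esub>g\<in>{g \<in> carrier G. a g \<noteq> \<zero>\<^bsub>K\<^esub>}. a g \<otimes>\<^bsub>K\<^esub> b (inv\<^bsub>G\<^esub> g \<otimes>\<^bsub>G\<^esub> x)),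
      one = (\<lambda>x\<in>carrier G. if x = \<one>\<^bsub>G\<^esub> then \<one>\<^bsub>K\<^esub> else \<zero>\<^bsub>K\<^esub>),
      zero = (\<lambda>x\<in>carrier G. \<zero>\<^bsub>K\<^esub>),
      add = (\<lambda>a b. \<lambda>x\<in>carrier G. a x \<oplus>\<^bsub>K\<^esub> b x) \<rparr>"

(* The image of g under the canonical map from G to K[G]. *)
definition group_algebra_of ::
    "('a, 'm) ring_scheme \<Rightarrow> ('g, 'n) monoid_scheme \<Rightarrow> 'g \<Rightarrow> 'g \<Rightarrow> 'a" where
  "group_algebra_of K G g = (\<lambda>x\<in>carrier G. if x = g then \<one>\<^bsub>K\<^esub> else \<zero>\<^bsub>K\<^esub>)"

(* The cycle l \<mapsto> l+1 \<mapsto> ... \<mapsto> j \<mapsto> l is cycle_of_list [l..<Suc j]; for j = l it is id. *)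
definition somewhere_to_below ::
    "('a, 'm) ring_scheme \<Rightarrow> nat \<Rightarrow> nat \<Rightarrow> (nat \<Rightarrow> nat) \<Rightarrow> 'a" where
  "somewhere_to_below K n l =
    (\<Oplus>\<^bsub>group_algebra K (sym_group n)\<^esub>j\<in>{l..n}.
       group_algebra_of K (sym_group n) (cycle_of_list [l..<Suc j]))"

definition ring_commutator :: "('a, 'm) ring_scheme \<Rightarrow> 'a \<Rightarrow> 'a \<Rightarrow> 'a" where
  "ring_commutator R a b = a \<otimes>\<^bsub>R\<^esub> b \<ominus>\<^bsub>R\<^esub> b \<otimes>\<^bsub>R\<^esub> a"

end

theory Submission
  imports Defs
begin

text \<open>
  Write \<open>s\<close> for the transposition of \<open>i\<close> and \<open>i + 1\<close>, and \<open>a = t\<^sub>i\<close>, \<open>b = t\<^sub>i\<^sub>+\<^sub>1\<close>.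
  Since \<open>cyc\<^bsub>i,\<dots>,j\<^esub> = s cyc\<^bsub>i+1,\<dots>,j\<^esub>\<close> for \<open>j > i\<close>, we have \<open>a = 1 + s b\<close>. Left multiplication
  by \<open>s\<close> merely permutes the terms of the expanded product \<open>b a\<close>, because
  \<open>cyc\<^bsub>i,\<dots>,j\<^esub> cyc\<^bsub>i,\<dots>,k\<^esub> = cyc\<^bsub>i+1,\<dots>,k\<^esub> cyc\<^bsub>i,\<dots>,j-1\<^esub>\<close> for \<open>i < j \<le> k\<close> and \<open>s\<close> is an involution.
  Hence \<open>b a = s b a = (a - 1) a\<close>, from which all three identities follow by ring arithmetic.
\<close>

section \<open>Double sums in commutative monoids\<close>

lemma (in comm_monoid) finprod_Times:
  assumes "finite A" "finite B" "\<And>x y. x \<in> A \<Longrightarrow> y \<in> B \<Longrightarrow> f x y \<in> carrier G"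
  shows "(\<Otimes>x\<in>A. \<Otimes>y\<in>B. f x y) = (\<Otimes>p\<in>A \<times> B. f (fst p) (snd p))"
proof -
  have "(\<Otimes>p\<in>A \<times> B. f (fst p) (snd p)) = (\<Otimes>p\<in>(\<Union>x\<in>A. Pair x ` B). f (fst p) (snd p))"
    by (rule finprod_cong') (use assms in auto)
  also have "\<dots> = (\<Otimes>x\<in>A. \<Otimes>p\<in>Pair x ` B. f (fst p) (snd p))"
    by (rule finprod_UN_disjoint) (use assms in \<open>auto simp: pairwise_def disjnt_def\<close>)
  also have "\<dots> = (\<Otimes>x\<in>A. \<Otimes>y\<in>B. f x y)"
  proof (rule finprod_cong')
    show "(\<Otimes>p\<in>Pair x ` B. f (fst p) (snd p)) = (\<Otimes>y\<in>B. f x y)" if "x \<in> A" for x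
      using that assms by (subst finprod_reindex) (auto simp: inj_on_def)
  qed (use assms in \<open>auto intro!: finprod_closed\<close>)
  finally show ?thesis ..
qed

text \<open>Both iterated products are products over pairs, and \<open>prod.swap\<close> matches the
  index sets. Associativity of the convolution rests on this.\<close>

lemma (in comm_monoid) finprod_swap:
  assumes "finite A" "finite B" "\<And>x y. x \<in> A \<Longrightarrow> y \<in> B \<Longrightarrow> f x y \<in> carrier G"
  shows "(\<Otimes>x\<in>A. \<Otimes>y\<in>B. f x y) = (\<Otimes>y\<in>B. \<Otimes>x\<in>A. f x y)"
proof -
  have "(\<Otimes>p\<in>A \<times> B. f (fst p) (snd p)) = (\<Otimes>p\<in>prod.swap ` (B \<times> A). f (fst p) (snd p))"
    by (simp add: product_swap)
  also have "\<dots> = (\<Otimes>p\<in>B \<times> A. f (snd p) (fst p))"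
    using assms by (subst finprod_reindex) auto
  finally show ?thesis
    using assms by (simp add: finprod_Times)
qed

section \<open>The group algebra of a finite group\<close>

text \<open>Finiteness makes the support condition in \<open>group_algebra\<close> automatic, so the
  carrier consists of all functions from the group to \<open>K\<close>.\<close>

locale finite_group_algebra = K: ring K + G: group G
  for K (structure) and G (structure) +
  assumes finite_carrier: "finite (carrier G)"
begin

abbreviation A where "A \<equiv> group_algebra K G"

abbreviation \<delta> where "\<delta> \<equiv> group_algebra_of K G"

lemma carrier_eq: "carrier A = carrier G \<rightarrow>\<^sub>E carrier K"
  using finite_carrier by (auto simp: group_algebra_def)

lemma apply_closed: "a \<in> carrier A \<Longrightarrow> x \<in> carrier G \<Longrightarrow> a x \<in> carrier K"
  by (auto simp: carrier_eq)

lemma eqI: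
  assumes "a \<in> carrier A" "b \<in> carrier A" "\<And>x. x \<in> carrier G \<Longrightarrow> a x = b x"
  shows "a = b"
  using assms unfolding carrier_eq by (rule PiE_ext)

lemma add_apply: "x \<in> carrier G \<Longrightarrow> (a \<oplus>\<^bsub>A\<^esub> b) x = a x \<oplus>\<^bsub>K\<^esub> b x"
  by (simp add: group_algebra_def)

lemma zero_apply: "x \<in> carrier G \<Longrightarrow> \<zero>\<^bsub>A\<^esub> x = \<zero>\<^bsub>K\<^esub>"
  by (simp add: group_algebra_def)

lemma of_apply: "x \<in> carrier G \<Longrightarrow> \<delta> g x = (if x = g then \<one>\<^bsub>K\<^esub> else \<zero>\<^bsub>K\<^esub>)"
  by (simp add: group_algebra_of_def)

lemma one_eq: "\<one>\<^bsub>A\<^esub> = \<delta> \<one>\<^bsub>G\<^esub>"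
  by (simp add: group_algebra_def group_algebra_of_def)

text \<open>Indices outside the support of \<open>a\<close> contribute zero terms. Summing over the
  whole group frees later reindexings from tracking supports.\<close>

lemma mult_apply:
  assumes "a \<in> carrier A" "b \<in> carrier A" "x \<in> carrier G"
  shows "(a \<otimes>\<^bsub>A\<^esub> b) x = (\<Oplus>\<^bsub>K\<^esub>g\<in>carrier G. a g \<otimes>\<^bsub>K\<^esub> b (inv\<^bsub>G\<^esub> g \<otimes>\<^bsub>G\<^esub> x))"
proof -
  have "(a \<otimes>\<^bsub>A\<^esub> b) x =
      (\<Oplus>\<^bsub>K\<^esub>g\<in>{g \<in> carrier G. a g \<noteq> \<zero>\<^bsub>K\<^esub>}. a g \<otimes>\<^bsub>K\<^esub> b (inv\<^bsub>G\<^esub> g \<otimes>\<^bsub>G\<^esub> x))"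
    using assms by (simp add: group_algebra_def)
  also have "\<dots> = (\<Oplus>\<^bsub>K\<^esub>g\<in>carrier G. a g \<otimes>\<^bsub>K\<^esub> b (inv\<^bsub>G\<^esub> g \<otimes>\<^bsub>G\<^esub> x))"
    by (rule K.add.finprod_mono_neutral_cong_left)
      (use assms finite_carrier in \<open>auto simp: apply_closed\<close>)
  finally show ?thesis .
qed

lemma add_closed: "a \<in> carrier A \<Longrightarrow> b \<in> carrier A \<Longrightarrow> a \<oplus>\<^bsub>A\<^esub> b \<in> carrier A"
  unfolding carrier_eq by (auto simp: group_algebra_def)

lemma zero_closed: "\<zero>\<^bsub>A\<^esub> \<in> carrier A"
  unfolding carrier_eq by (auto simp: group_algebra_def)

lemma of_closed: "\<delta> g \<in> carrier A"
  unfolding carrier_eq by (auto simp: group_algebra_of_def)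

lemma mult_closed:
  assumes "a \<in> carrier A" "b \<in> carrier A"
  shows "a \<otimes>\<^bsub>A\<^esub> b \<in> carrier A"
proof -
  have "(a \<otimes>\<^bsub>A\<^esub> b) x \<in> carrier K" if "x \<in> carrier G" for x
    using assms that by (auto simp: mult_apply apply_closed intro!: K.finsum_closed)
  moreover have "a \<otimes>\<^bsub>A\<^esub> b \<in> extensional (carrier G)"
    by (simp add: group_algebra_def)
  ultimately show ?thesis
    unfolding carrier_eq by (auto simp: PiE_def)
qed

text \<open>Only the index \<open>h = g\<close> survives in the convolution sum, so
  \<open>\<delta> g\<close> acts from the left by translating the argument.\<close>

lemma of_mult_apply:
  assumes "g \<in> carrier G" "b \<in> carrier A" "x \<in> carrier G"
  shows "(\<delta> g \<otimes>\<^bsub>A\<^esub> b) x = b (inv\<^bsub>G\<^esub> g \<otimes>\<^bsub>G\<^esub> x)"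
proof -
  have "(\<delta> g \<otimes>\<^bsub>A\<^esub> b) x =
      (\<Oplus>\<^bsub>K\<^esub>h\<in>carrier G. if g = h then b (inv\<^bsub>G\<^esub> h \<otimes>\<^bsub>G\<^esub> x) else \<zero>\<^bsub>K\<^esub>)"
    unfolding mult_apply[OF of_closed assms(2,3)]
    by (rule K.finsum_cong') (use assms in \<open>auto simp: of_apply apply_closed\<close>)
  also have "\<dots> = b (inv\<^bsub>G\<^esub> g \<otimes>\<^bsub>G\<^esub> x)"
    using assms finite_carrier by (intro K.finsum_singleton) (auto simp: apply_closed)
  finally show ?thesis .
qed

lemma of_mult_of:
  assumes "g \<in> carrier G" "h \<in> carrier G"
  shows "\<delta> g \<otimes>\<^bsub>A\<^esub> \<delta> h = \<delta> (g \<otimes>\<^bsub>G\<^esub> h)"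
proof (rule eqI)
  show "(\<delta> g \<otimes>\<^bsub>A\<^esub> \<delta> h) x = \<delta> (g \<otimes>\<^bsub>G\<^esub> h) x" if "x \<in> carrier G" for x
    using assms that by (auto simp: of_mult_apply of_closed of_apply G.inv_solve_left')
qed (auto intro: mult_closed of_closed)

lemma l_one: "a \<in> carrier A \<Longrightarrow> \<one>\<^bsub>A\<^esub> \<otimes>\<^bsub>A\<^esub> a = a"
  by (rule eqI) (auto simp: one_eq of_mult_apply intro: mult_closed of_closed)

lemma r_one:
  assumes "a \<in> carrier A"
  shows "a \<otimes>\<^bsub>A\<^esub> \<one>\<^bsub>A\<^esub> = a"
proof (rule eqI)
  fix x assume x: "x \<in> carrier G"
  have "(a \<otimes>\<^bsub>A\<^esub> \<one>\<^bsub>A\<^esub>) x = (\<Oplus>\<^bsub>K\<^esub>g\<in>carrier G. if x = g then a g else \<zero>\<^bsub>K\<^esub>)"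
    unfolding one_eq mult_apply[OF assms of_closed x]
    by (rule K.finsum_cong')
      (use assms x in \<open>auto simp: of_apply apply_closed G.inv_solve_left'\<close>)
  also have "\<dots> = a x"
    using assms x finite_carrier by (intro K.finsum_singleton) (auto simp: apply_closed)
  finally show "(a \<otimes>\<^bsub>A\<^esub> \<one>\<^bsub>A\<^esub>) x = a x" .
qed (use assms in \<open>auto simp: one_eq intro: mult_closed of_closed\<close>)

text \<open>Both sides expand to double sums; they agree after exchanging the summations and
  substituting \<open>h g\<close> for \<open>g\<close> in the inner sum.\<close>

lemma mult_assoc:
  assumes "a \<in> carrier A" "b \<in> carrier A" "c \<in> carrier A"
  shows "(a \<otimes>\<^bsub>A\<^esub> b) \<otimes>\<^bsub>A\<^esub> c = a \<otimes>\<^bsub>A\<^esub> (b \<otimes>\<^bsub>A\<^esub> c)"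
proof (rule eqI)
  fix x assume x: "x \<in> carrier G"
  note closed = assms x apply_closed finite_carrier
  let ?F = "\<lambda>g h. a h \<otimes>\<^bsub>K\<^esub> (b (inv\<^bsub>G\<^esub> h \<otimes>\<^bsub>G\<^esub> g) \<otimes>\<^bsub>K\<^esub> c (inv\<^bsub>G\<^esub> g \<otimes>\<^bsub>G\<^esub> x))"
  have "((a \<otimes>\<^bsub>A\<^esub> b) \<otimes>\<^bsub>A\<^esub> c) x = (\<Oplus>\<^bsub>K\<^esub>g\<in>carrier G. \<Oplus>\<^bsub>K\<^esub>h\<in>carrier G. ?F g h)"
    unfolding mult_apply[OF mult_closed[OF assms(1,2)] assms(3) x]
  proof (rule K.finsum_cong')
    fix g assume g: "g \<in> carrier G"
    have "(a \<otimes>\<^bsub>A\<^esub> b) g \<otimes>\<^bsub>K\<^esub> c (inv\<^bsub>G\<^esub> g \<otimes>\<^bsub>G\<^esub> x) =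
        (\<Oplus>\<^bsub>K\<^esub>h\<in>carrier G. (a h \<otimes>\<^bsub>K\<^esub> b (inv\<^bsub>G\<^esub> h \<otimes>\<^bsub>G\<^esub> g)) \<otimes>\<^bsub>K\<^esub> c (inv\<^bsub>G\<^esub> g \<otimes>\<^bsub>G\<^esub> x))"
      unfolding mult_apply[OF assms(1,2) g]
      by (rule K.finsum_ldistr) (use g closed in auto)
    also have "\<dots> = (\<Oplus>\<^bsub>K\<^esub>h\<in>carrier G. ?F g h)"
      by (rule K.finsum_cong') (use g closed in \<open>auto simp: K.m_assoc\<close>)
    finally show "(a \<otimes>\<^bsub>A\<^esub> b) g \<otimes>\<^bsub>K\<^esub> c (inv\<^bsub>G\<^esub> g \<otimes>\<^bsub>G\<^esub> x) = \<dots>" .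
  qed (use closed in \<open>auto intro!: K.finsum_closed\<close>)
  also have "\<dots> = (\<Oplus>\<^bsub>K\<^esub>h\<in>carrier G. \<Oplus>\<^bsub>K\<^esub>g\<in>carrier G. ?F g h)"
    by (rule K.add.finprod_swap) (use closed in auto)
  also have "\<dots> = (\<Oplus>\<^bsub>K\<^esub>h\<in>carrier G. a h \<otimes>\<^bsub>K\<^esub> (b \<otimes>\<^bsub>A\<^esub> c) (inv\<^bsub>G\<^esub> h \<otimes>\<^bsub>G\<^esub> x))"
  proof (rule K.finsum_cong')
    fix h assume h: "h \<in> carrier G"
    \<comment> \<open>Left translation by \<open>h\<close> permutes the group, which justifies the
      substitution; afterwards the argument of \<open>b\<close> is just \<open>g\<close>.\<close>
    have img: "(\<otimes>\<^bsub>G\<^esub>) h ` carrier G = carrier G"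
      using h by (rule G.surj_const_mult)
    have "(\<Oplus>\<^bsub>K\<^esub>g\<in>carrier G. ?F g h) = (\<Oplus>\<^bsub>K\<^esub>g\<in>(\<otimes>\<^bsub>G\<^esub>) h ` carrier G. ?F g h)"
      by (simp add: img)
    also have "\<dots> = (\<Oplus>\<^bsub>K\<^esub>g\<in>carrier G. ?F (h \<otimes>\<^bsub>G\<^esub> g) h)"
      by (rule K.add.finprod_reindex) (use h closed G.inj_on_cmult in \<open>auto simp: img\<close>)
    also have "\<dots> = (\<Oplus>\<^bsub>K\<^esub>g\<in>carrier G.
        a h \<otimes>\<^bsub>K\<^esub> (b g \<otimes>\<^bsub>K\<^esub> c (inv\<^bsub>G\<^esub> g \<otimes>\<^bsub>G\<^esub> (inv\<^bsub>G\<^esub> h \<otimes>\<^bsub>G\<^esub> x))))"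
      by (rule K.finsum_cong')
        (use h closed in \<open>auto simp: G.inv_mult_group G.m_assoc[symmetric]\<close>)
    also have "\<dots> = a h \<otimes>\<^bsub>K\<^esub> (b \<otimes>\<^bsub>A\<^esub> c) (inv\<^bsub>G\<^esub> h \<otimes>\<^bsub>G\<^esub> x)"
      using h closed by (simp add: mult_apply K.finsum_rdistr)
    finally show "(\<Oplus>\<^bsub>K\<^esub>g\<in>carrier G. ?F g h) = \<dots>" .
  qed (use closed mult_closed in auto)
  also have "\<dots> = (a \<otimes>\<^bsub>A\<^esub> (b \<otimes>\<^bsub>A\<^esub> c)) x"
    using assms x by (simp add: mult_apply[OF _ mult_closed])
  finally show "((a \<otimes>\<^bsub>A\<^esub> b) \<otimes>\<^bsub>A\<^esub> c) x = (a \<otimes>\<^bsub>A\<^esub> (b \<otimes>\<^bsub>A\<^esub> c)) x" .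
qed (use assms in \<open>auto intro: mult_closed\<close>)

lemma distrib_right:
  assumes "a \<in> carrier A" "b \<in> carrier A" "c \<in> carrier A"
  shows "(a \<oplus>\<^bsub>A\<^esub> b) \<otimes>\<^bsub>A\<^esub> c = a \<otimes>\<^bsub>A\<^esub> c \<oplus>\<^bsub>A\<^esub> b \<otimes>\<^bsub>A\<^esub> c"
proof (rule eqI)
  fix x assume x: "x \<in> carrier G"
  have "((a \<oplus>\<^bsub>A\<^esub> b) \<otimes>\<^bsub>A\<^esub> c) x =
      (\<Oplus>\<^bsub>K\<^esub>g\<in>carrier G. a g \<otimes>\<^bsub>K\<^esub> c (inv\<^bsub>G\<^esub> g \<otimes>\<^bsub>G\<^esub> x) \<oplus>\<^bsub>K\<^esub> b g \<otimes>\<^bsub>K\<^esub> c (inv\<^bsub>G\<^esub> g \<otimes>\<^bsub>G\<^esub> x))"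
    unfolding mult_apply[OF add_closed[OF assms(1,2)] assms(3) x]
    by (rule K.finsum_cong') (use assms x in \<open>auto simp: add_apply apply_closed K.l_distr\<close>)
  also have "\<dots> = (a \<otimes>\<^bsub>A\<^esub> c \<oplus>\<^bsub>A\<^esub> b \<otimes>\<^bsub>A\<^esub> c) x"
    using assms x by (simp add: add_apply mult_apply apply_closed K.finsum_addf)
  finally show "((a \<oplus>\<^bsub>A\<^esub> b) \<otimes>\<^bsub>A\<^esub> c) x = (a \<otimes>\<^bsub>A\<^esub> c \<oplus>\<^bsub>A\<^esub> b \<otimes>\<^bsub>A\<^esub> c) x" .
qed (use assms in \<open>auto intro: mult_closed add_closed\<close>)

lemma distrib_left:
  assumes "a \<in> carrier A" "b \<in> carrier A" "c \<in> carrier A"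
  shows "c \<otimes>\<^bsub>A\<^esub> (a \<oplus>\<^bsub>A\<^esub> b) = c \<otimes>\<^bsub>A\<^esub> a \<oplus>\<^bsub>A\<^esub> c \<otimes>\<^bsub>A\<^esub> b"
proof (rule eqI)
  fix x assume x: "x \<in> carrier G"
  have "(c \<otimes>\<^bsub>A\<^esub> (a \<oplus>\<^bsub>A\<^esub> b)) x =
      (\<Oplus>\<^bsub>K\<^esub>g\<in>carrier G. c g \<otimes>\<^bsub>K\<^esub> a (inv\<^bsub>G\<^esub> g \<otimes>\<^bsub>G\<^esub> x) \<oplus>\<^bsub>K\<^esub> c g \<otimes>\<^bsub>K\<^esub> b (inv\<^bsub>G\<^esub> g \<otimes>\<^bsub>G\<^esub> x))"
    unfolding mult_apply[OF assms(3) add_closed[OF assms(1,2)] x]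
    by (rule K.finsum_cong') (use assms x in \<open>auto simp: add_apply apply_closed K.r_distr\<close>)
  also have "\<dots> = (c \<otimes>\<^bsub>A\<^esub> a \<oplus>\<^bsub>A\<^esub> c \<otimes>\<^bsub>A\<^esub> b) x"
    using assms x by (simp add: add_apply mult_apply apply_closed K.finsum_addf)
  finally show "(c \<otimes>\<^bsub>A\<^esub> (a \<oplus>\<^bsub>A\<^esub> b)) x = (c \<otimes>\<^bsub>A\<^esub> a \<oplus>\<^bsub>A\<^esub> c \<otimes>\<^bsub>A\<^esub> b) x" .
qed (use assms in \<open>auto intro: mult_closed add_closed\<close>)

lemma abelian_group_group_algebra: "abelian_group A"
proof (rule abelian_groupI)
  fix a assume a: "a \<in> carrier A"
  let ?b = "\<lambda>x\<in>carrier G. \<ominus>\<^bsub>K\<^esub> a x"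
  have b: "?b \<in> carrier A"
    using a by (auto simp: carrier_eq)
  have "?b \<oplus>\<^bsub>A\<^esub> a = \<zero>\<^bsub>A\<^esub>"
    using a b by (intro eqI)
      (auto simp: add_apply zero_apply apply_closed K.l_neg intro: add_closed zero_closed)
  with b show "\<exists>b\<in>carrier A. b \<oplus>\<^bsub>A\<^esub> a = \<zero>\<^bsub>A\<^esub>" by (intro bexI[of _ ?b])
qed (auto intro!: eqI add_closed zero_closed
      simp: add_apply zero_apply apply_closed K.a_ac)

sublocale A: ring A
  by (rule ringI[OF abelian_group_group_algebra])
    (auto intro!: monoidI mult_closed l_one r_one mult_assoc distrib_right distrib_left
      simp: one_eq of_closed)

end

section \<open>Cycles of consecutive numbers\<close>

abbreviation cyc :: "nat \<Rightarrow> nat \<Rightarrow> nat \<Rightarrow> nat" where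
  "cyc l j \<equiv> cycle_of_list [l..<Suc j]"

text \<open>\<open>cycle_of_list\<close> peels transpositions off the front of its list, so the
  interval must be unfolded from the left; \<open>upt_Suc\<close> would split off the last element
  instead.\<close>

lemma cyc_Suc:
  assumes "l < j"
  shows "cyc l j = transpose l (Suc l) \<circ> cyc (Suc l) j"
  using assms by (simp add: upt_conv_Cons del: upt_Suc)

lemma cyc_refl: "cyc l l = id"
  by simp

text \<open>Downward induction on \<open>l\<close>: the shorter cycle fixes \<open>l\<close> and
  sends \<open>j\<close> to \<open>Suc l\<close>, and the new transposition redirects these two
  images to \<open>Suc l\<close> and \<open>l\<close>.\<close>

lemma cyc_apply:
  assumes "l \<le> j"
  shows "cyc l j x = (if l \<le> x \<and> x < j then Suc x else if x = j then l else x)"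
  using assms
proof (induction l rule: inc_induct)
  case base
  show ?case by simp
next
  case (step l)
  then show ?case by (auto simp: cyc_Suc transpose_def simp del: upt_Suc)
qed

text \<open>Both sides send \<open>x\<close> to \<open>x + 2\<close> for
  \<open>i \<le> x < j\<close>, \<open>j\<close> to \<open>i\<close>, \<open>x\<close> to
  \<open>x + 1\<close> for \<open>j < x < k\<close>, and \<open>k\<close> to \<open>i + 1\<close>.
  Using \<open>Suc j\<close> on the left avoids a truncated subtraction.\<close>

lemma cyc_comp_cyc:
  assumes "i \<le> j" "j < k"
  shows "cyc i (Suc j) \<circ> cyc i k = cyc (Suc i) k \<circ> cyc i j"
proof
  show "(cyc i (Suc j) \<circ> cyc i k) x = (cyc (Suc i) k \<circ> cyc i j) x" for x
    using assms by (auto simp: cyc_apply simp del: upt_Suc)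
qed

lemma cyc_in_sym_group:
  assumes "1 \<le> l" "j \<le> n"
  shows "cyc l j \<in> carrier (sym_group n)"
  unfolding sym_group_carrier
  by (rule permutes_subset[OF cycle_permutes]) (use assms in auto)

section \<open>Somewhere-to-below shuffles\<close>

context
  fixes K :: "('a, 'm) ring_scheme" (structure) and n i :: nat
  assumes K: "ring K" and i: "i \<in> {1..n - 1}"
begin

interpretation finite_group_algebra K "sym_group n"
  using K sym_group_is_group
  by (auto simp: finite_group_algebra_def finite_group_algebra_axioms_def sym_group_def
      intro: finite_permutations)

abbreviation (input) s where "s \<equiv> transpose i (Suc i)"

lemma s_in_sym_group: "s \<in> carrier (sym_group n)"
  \<comment> \<open>The range of \<open>i\<close> gives \<open>Suc i \<le> n\<close>, since
    \<open>{1..n - 1}\<close> is empty for \<open>n < 2\<close>.\<close>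
  unfolding sym_group_carrier using i by (auto intro: permutes_swap_id)

lemma somewhere_to_below_closed: "somewhere_to_below K n l \<in> carrier A"
  unfolding somewhere_to_below_def by (rule A.finsum_closed) (auto intro: of_closed)

text \<open>The summand \<open>j = i\<close> is the identity; every other summand has
  \<open>i < j\<close>, so \<open>cyc_Suc\<close> extracts a left factor \<open>s\<close>.\<close>

lemma somewhere_to_below_rec:
  "somewhere_to_below K n i = \<one>\<^bsub>A\<^esub> \<oplus>\<^bsub>A\<^esub> \<delta> s \<otimes>\<^bsub>A\<^esub> somewhere_to_below K n (Suc i)"
proof -
  have "\<delta> s \<otimes>\<^bsub>A\<^esub> somewhere_to_below K n (Suc i) =
      (\<Oplus>\<^bsub>A\<^esub>j\<in>{Suc i..n}. \<delta> s \<otimes>\<^bsub>A\<^esub> \<delta> (cyc (Suc i) j))"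
    unfolding somewhere_to_below_def by (rule A.finsum_rdistr) (auto intro: of_closed)
  also have "\<dots> = (\<Oplus>\<^bsub>A\<^esub>j\<in>{Suc i..n}. \<delta> (cyc i j))"
    by (rule A.finsum_cong')
      (auto simp: of_mult_of s_in_sym_group cyc_in_sym_group sym_group_mult cyc_Suc of_closed
        simp del: upt_Suc)
  finally have "\<one>\<^bsub>A\<^esub> \<oplus>\<^bsub>A\<^esub> \<delta> s \<otimes>\<^bsub>A\<^esub> somewhere_to_below K n (Suc i) =
      \<delta> (cyc i i) \<oplus>\<^bsub>A\<^esub> (\<Oplus>\<^bsub>A\<^esub>j\<in>{Suc i..n}. \<delta> (cyc i j))"
    by (simp add: one_eq sym_group_one cyc_refl del: upt_Suc)
  also have "\<dots> = (\<Oplus>\<^bsub>A\<^esub>j\<in>insert i {Suc i..n}. \<delta> (cyc i j))"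
    by (rule A.finsum_insert[symmetric]) (auto intro: of_closed)
  also have "insert i {Suc i..n} = {i..n}"
    using i by auto
  finally show ?thesis
    by (simp add: somewhere_to_below_def)
qed

text \<open>The product expands into terms indexed by pairs \<open>(j, k)\<close>, and left
  multiplication by \<open>s\<close> moves these terms along an involution \<open>\<tau>\<close> of
  the index set.\<close>

lemma s_mult_somewhere_to_below_mult:
  "\<delta> s \<otimes>\<^bsub>A\<^esub> (somewhere_to_below K n (Suc i) \<otimes>\<^bsub>A\<^esub> somewhere_to_below K n i) =
   somewhere_to_below K n (Suc i) \<otimes>\<^bsub>A\<^esub> somewhere_to_below K n i"
proof -
  define I where "I = {Suc i..n} \<times> {i..n}"
  define P where "P = (\<lambda>(j, k). cyc (Suc i) j \<circ> cyc i k)"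
  \<comment> \<open>For \<open>j \<le> k\<close>, multiplying by \<open>s\<close> turns
    \<open>cyc (Suc i) j\<close> into \<open>cyc i j\<close>, and \<open>cyc_comp_cyc\<close> then
    yields the pair \<open>(k, j - 1)\<close>. The other branch inverts this one. The subtraction is
    genuine because \<open>j \<ge> Suc i\<close>.\<close>
  define \<tau> where "\<tau> = (\<lambda>(j, k). if j \<le> k then (k, j - 1) else (Suc k, j))"
  have fin: "finite I"
    by (simp add: I_def)
  have P_closed: "P p \<in> carrier (sym_group n)" if "p \<in> I" for p
    using that i G.m_closed[OF cyc_in_sym_group cyc_in_sym_group]
    by (auto simp: I_def P_def sym_group_mult simp del: upt_Suc)
  have \<tau>_closed: "\<tau> p \<in> I" and \<tau>_invol: "\<tau> (\<tau> p) = p" if "p \<in> I" for p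
    using that by (auto simp: I_def \<tau>_def split: if_splits)
  have s_P_le: "s \<circ> P (j, k) = P (\<tau> (j, k))" if jk: "(j, k) \<in> I" "j \<le> k" for j k
  proof -
    \<comment> \<open>Here \<open>m\<close> is \<open>j - 1\<close>, which brings the indices into
      the form required by \<open>cyc_comp_cyc\<close>.\<close>
    obtain m where "j = Suc m" "i \<le> m" "m < k"
      using jk by (cases j) (auto simp: I_def)
    then show ?thesis
      using jk cyc_comp_cyc[of i m k] cyc_Suc[of i j]
      by (simp add: P_def \<tau>_def comp_assoc del: upt_Suc)
  qed
  have s_P: "s \<circ> P p = P (\<tau> p)" if p: "p \<in> I" for p
  proof (cases "fst p \<le> snd p")
    case True
    then show ?thesis using s_P_le p by (metis prod.collapse)
  next
    case False
    \<comment> \<open>\<open>\<tau>\<close> carries this half of the index set into the half already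
      treated; applying that case to \<open>\<tau> p\<close> and cancelling
      \<open>s \<circ> s = id\<close> settles the claim.\<close>
    then have "fst (\<tau> p) \<le> snd (\<tau> p)"
      by (auto simp: \<tau>_def split: prod.splits)
    then have "s \<circ> P (\<tau> p) = P p"
      using s_P_le \<tau>_closed[OF p] \<tau>_invol[OF p] by (metis prod.collapse)
    then have "s \<circ> P p = (s \<circ> s) \<circ> P (\<tau> p)"
      by (metis comp_assoc)
    then show ?thesis by simp
  qed
  have \<tau>_bij: "bij_betw \<tau> I I"
    using \<tau>_closed \<tau>_invol by (auto intro!: bij_betw_byWitness[where f' = \<tau>])
  have "somewhere_to_below K n (Suc i) \<otimes>\<^bsub>A\<^esub> somewhere_to_below K n i =
      (\<Oplus>\<^bsub>A\<^esub>j\<in>{Suc i..n}. \<delta> (cyc (Suc i) j) \<otimes>\<^bsub>A\<^esub> somewhere_to_below K n i)"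
    unfolding somewhere_to_below_def[of K n "Suc i"]
    by (rule A.finsum_ldistr) (auto intro: of_closed somewhere_to_below_closed)
  also have "\<dots> = (\<Oplus>\<^bsub>A\<^esub>j\<in>{Suc i..n}. \<Oplus>\<^bsub>A\<^esub>k\<in>{i..n}. \<delta> (cyc (Suc i) j) \<otimes>\<^bsub>A\<^esub> \<delta> (cyc i k))"
    unfolding somewhere_to_below_def
    by (rule A.finsum_cong')
      (auto intro!: A.finsum_closed A.finsum_rdistr mult_closed of_closed simp del: upt_Suc)
  also have "\<dots> = (\<Oplus>\<^bsub>A\<^esub>p\<in>I. \<delta> (cyc (Suc i) (fst p)) \<otimes>\<^bsub>A\<^esub> \<delta> (cyc i (snd p)))"
    unfolding I_def by (rule A.add.finprod_Times) (auto intro: mult_closed of_closed)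
  also have "\<dots> = (\<Oplus>\<^bsub>A\<^esub>p\<in>I. \<delta> (P p))"
    using i by (intro A.finsum_cong')
      (auto simp: I_def P_def of_mult_of cyc_in_sym_group sym_group_mult of_closed
        simp del: upt_Suc)
  finally have expand: "somewhere_to_below K n (Suc i) \<otimes>\<^bsub>A\<^esub> somewhere_to_below K n i =
      (\<Oplus>\<^bsub>A\<^esub>p\<in>I. \<delta> (P p))" .
  have "\<delta> s \<otimes>\<^bsub>A\<^esub> (\<Oplus>\<^bsub>A\<^esub>p\<in>I. \<delta> (P p)) = (\<Oplus>\<^bsub>A\<^esub>p\<in>I. \<delta> s \<otimes>\<^bsub>A\<^esub> \<delta> (P p))"
    by (rule A.finsum_rdistr) (auto intro: fin of_closed)
  also have "\<dots> = (\<Oplus>\<^bsub>A\<^esub>p\<in>I. \<delta> (P (\<tau> p)))"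
    by (rule A.finsum_cong')
      (auto simp: of_mult_of s_in_sym_group P_closed sym_group_mult s_P of_closed)
  \<comment> \<open>As \<open>\<tau>\<close> permutes \<open>I\<close>, reindexing along it restores
    the original sum.\<close>
  also have "\<dots> = (\<Oplus>\<^bsub>A\<^esub>p\<in>\<tau> ` I. \<delta> (P p))"
    using \<tau>_bij by (intro A.add.finprod_reindex[symmetric]) (auto simp: bij_betw_def of_closed)
  also have "\<tau> ` I = I"
    using \<tau>_bij by (simp add: bij_betw_def)
  finally show ?thesis
    by (simp add: expand)
qed

text \<open>With \<open>a\<close> and \<open>b\<close> as in the proof, the recursion reads
  \<open>a - 1 = s b\<close>; hence \<open>(a - 1) a = s (b a)\<close>, and the factor
  \<open>s\<close> is absorbed.\<close>

lemma somewhere_to_below_Suc_mult: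
  "somewhere_to_below K n (Suc i) \<otimes>\<^bsub>A\<^esub> somewhere_to_below K n i =
   (somewhere_to_below K n i \<ominus>\<^bsub>A\<^esub> \<one>\<^bsub>A\<^esub>) \<otimes>\<^bsub>A\<^esub> somewhere_to_below K n i"
proof -
  let ?a = "somewhere_to_below K n i" and ?b = "somewhere_to_below K n (Suc i)"
  have "\<one>\<^bsub>A\<^esub> \<oplus>\<^bsub>A\<^esub> u \<ominus>\<^bsub>A\<^esub> \<one>\<^bsub>A\<^esub> = u" if "u \<in> carrier A" for u
    using that A.one_closed by algebra
  then have "?a \<ominus>\<^bsub>A\<^esub> \<one>\<^bsub>A\<^esub> = \<delta> s \<otimes>\<^bsub>A\<^esub> ?b"
    by (metis somewhere_to_below_rec mult_closed of_closed somewhere_to_below_closed)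
  then show ?thesis
    by (metis s_mult_somewhere_to_below_mult mult_assoc of_closed somewhere_to_below_closed)
qed

end

section \<open>Commutator arithmetic in a ring and the conclusion\<close>

lemma (in ring) commutator_identities:
  assumes a: "a \<in> carrier R" and b: "b \<in> carrier R" and ba: "b \<otimes> a = (a \<ominus> \<one>) \<otimes> a"
  shows "ring_commutator R a b = a \<otimes> (b \<ominus> (a \<ominus> \<one>))"
    and "ring_commutator R a b \<otimes> a = \<zero>"
    and "ring_commutator R a b [^] (2::nat) = \<zero>"
proof -
  have c: "ring_commutator R a b \<in> carrier R"
    using a b by (simp add: ring_commutator_def)
  \<comment> \<open>Since \<open>a\<close> commutes with \<open>a - 1\<close>, the subtracted
    product \<open>b a\<close> also has \<open>a\<close> as a left factor, which can be pulled out
    of the commutator.\<close>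
  have "(a \<ominus> \<one>) \<otimes> a = a \<otimes> (a \<ominus> \<one>)"
    using a by (simp add: minus_eq l_distr r_distr l_minus r_minus)
  then show 1: "ring_commutator R a b = a \<otimes> (b \<ominus> (a \<ominus> \<one>))"
    unfolding ring_commutator_def ba using a b one_closed by algebra
  have "(b \<ominus> (a \<ominus> \<one>)) \<otimes> a = b \<otimes> a \<ominus> (a \<ominus> \<one>) \<otimes> a"
    using a b one_closed by algebra
  also have "\<dots> = \<zero>"
    using a by (simp add: ba minus_eq r_neg)
  finally show 2: "ring_commutator R a b \<otimes> a = \<zero>"
    using a b by (simp add: 1 m_assoc)
  \<comment> \<open>Only the second factor of the square is expanded, so that its leading
    \<open>a\<close> meets the remaining commutator and the second identity applies.\<close>
  have "ring_commutator R a b [^] (2::nat) =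
      ring_commutator R a b \<otimes> (a \<otimes> (b \<ominus> (a \<ominus> \<one>)))"
    using c by (simp add: numeral_2_eq_2 flip: 1)
  also have "\<dots> = ring_commutator R a b \<otimes> a \<otimes> (b \<ominus> (a \<ominus> \<one>))"
    using a b c by (simp add: m_assoc)
  also have "\<dots> = \<zero>"
    using a b by (simp add: 2)
  finally show "ring_commutator R a b [^] (2::nat) = \<zero>" .
qed

theorem corollary5p2:
  fixes K :: "('a, 'm) ring_scheme" and n i :: nat
  defines "A \<equiv> group_algebra K (sym_group n)"
    and "t \<equiv> somewhere_to_below K n"
  assumes "cring K" and "i \<in> {1..n - 1}"
  shows "ring_commutator A (t i) (t (i + 1)) =
           t i \<otimes>\<^bsub>A\<^esub> (t (i + 1) \<ominus>\<^bsub>A\<^esub> (t i \<ominus>\<^bsub>A\<^esub> \<one>\<^bsub>A\<^esub>))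
       \<and> ring_commutator A (t i) (t (i + 1)) \<otimes>\<^bsub>A\<^esub> t i = \<zero>\<^bsub>A\<^esub>
       \<and> ring_commutator A (t i) (t (i + 1)) [^]\<^bsub>A\<^esub> (2::nat) = \<zero>\<^bsub>A\<^esub>"
proof -
  have K: "ring K"
    using \<open>cring K\<close> by (rule cring.axioms)
  interpret finite_group_algebra K "sym_group n"
    using K sym_group_is_group
    by (auto simp: finite_group_algebra_def finite_group_algebra_axioms_def sym_group_def
        intro: finite_permutations)
  show ?thesis
    unfolding A_def t_def
    \<comment> \<open>The relation \<open>b a = (a - 1) a\<close> carries all the information about
      permutations; everything else is ring arithmetic.\<close>
    using A.commutator_identities[OF somewhere_to_below_closed[OF K assms(4)]
        somewhere_to_below_closed[OF K assms(4)] somewhere_to_below_Suc_mult[OF K assms(4)]]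
    by simp
qed

end
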